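(* Let $\mathbb H=(V,\mathcal H)$ be a complete $3$-uniform hypergraph of order $q=|V|\ge5$, let $\mathcal J\subset\mathcal H$ be a set of pairwise disjoint hyperedges, let $J=\bigcup_{H\in\mathcal J}H$, and let $\mathbb H'=(V,\mathcal H')$ with $\mathcal H'=\mathcal H\setminus\mathcal J$. Then the matching model $(\mathbb H',\textsc{ml},\mu)$ is stable for any $\mu\in\mathscr M(V)$ satisfying all of the following: (1) $\lambda_i(\mu)<0$ for all $i\in V\setminus J$, and $\nu_i(\mu)<0$ for all $i\in J$; (2) $\mu(T)>1/3$ for every transversal $T$ of $\mathbb H'$; (3) $\mu(i)<1/3$ for every $i\in V$. Here $\lambda_i(\mu)$, $\nu_i(\mu)$ are the explicit polynomials in $(\mu(v))_{v\in V}$ given in the context.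
   Context: A hypergraph $(V,\mathcal H)$ consists of a finite node set $V$ and a finite set $\mathcal H$ of subsets (hyperedges) whose union is $V$; complete $3$-uniform means $\mathcal H$ is the set of all $3$-element subsets of $V$. A transversal is a set $T\subset V$ meeting every hyperedge. $\mathscr M(V)$ is the set of probability measures $\mu$ on $V$ with $\mu(i)>0$ for all $i$. Matching model $(\mathbb H',\Phi,\mu)$: at each time $n\ge1$ one item enters; its class $C_n\in V$ is drawn from $\mu$, i.i.d. If the buffer contains a set of items whose classes form, together with $C_n$, a hyperedge of $\mathcal H'$ (one item per class), the policy $\Phi$ selects one such set and these items leave immediately together with the incoming item (a match is always performed whenever possible); otherwise the incoming item is stored. $W_n$ is the word over $V$ listing the classes of unmatched items after the arrival at time $n$, in order of arrival; $(W_n)$ is a Markov chain and the model is stable if it is positive recurrent. Policy $\textsc{ml}$ (Match the Longest): if $x(i)$ is the number of stored items of class $i$ and the incoming class is $v$, choose a hyperedge $S\ni v$ with $x(i)>0$ for all $i\in S\setminus\{v\}$ maximizing $\sum_{i\in S}x(i)$, ties being broken uniformly at random; within a class the oldest item is used. Notation: all sums below run over pairwise distinct indices, and each distinct monomial is counted exactly once. For $i\in V\setminus J$, with all indices $j,k,\ell,m$ in $V\setminus\{i\}$ and distinct: $$\begin{aligned}\lambda_i(\mu)=\;&8\mu(i)^4+24\mu(i)^3\sum_{j}\mu(j)+24\mu(i)^2\sum_{j}\mu(j)^2+8\mu(i)\sum_{j}\mu(j)^3+24\mu(i)^2\sum_{\{j,k\}}\mu(j)\mu(k)\\&-44\sum_{j,\{k,\ell\}}\mu(j)^2\mu(k)\mu(\ell)-24\sum_{\{j,k\}}\mu(j)^2\mu(k)^2-8\sum_{(j,k)}\mu(j)\mu(k)^3-96\sum_{\{j,k,\ell,m\}}\mu(j)\mu(k)\mu(\ell)\mu(m).\end{aligned}$$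 For $i\in J$, let $H=\{i,j,k\}$ be the unique element of $\mathcal J$ containing $i$; let $a$ range over $\{j,k\}$, let $(a,b)$ range over the two orderings $(j,k),(k,j)$, and let $\ell,m,p,s$ be distinct elements of $\overline H=V\setminus H$ (except in the first line, where $u$ ranges over $V\setminus\{i\}$). Then $$\begin{aligned}\nu_i(\mu)=\;&8\mu(i)^4+24\mu(i)^3\sum_{u}\mu(u)+24\mu(i)^2\sum_{u}\mu(u)^2+8\mu(i)\sum_{u}\mu(u)^3\\ &-8\sum_{a,\ell}\mu(a)\mu(\ell)^3-24\sum_{(a,b),\ell}\mu(a)\mu(b)^2\mu(\ell)-48\mu(j)\mu(k)\sum_{\ell}\mu(\ell)^2-44\sum_{a,(\ell,m)}\mu(a)\mu(\ell)^2\mu(m)\\ &+48\mu(i)^2\mu(j)\mu(k)-88\,\mu(j)\mu(k)\sum_{\{\ell,m\}}\mu(\ell)\mu(m)-96\sum_{a,\{\ell,m,p\}}\mu(a)\mu(\ell)\mu(m)\mu(p)\\ &+24\mu(i)^2\sum_{a,\ell}\mu(a)\mu(\ell)+24\mu(i)^2\sum_{\{\ell,m\}}\mu(\ell)\mu(m)-24\sum_{a,\ell}\mu(a)^2\mu(\ell)^2\\ &-44\sum_{a,\{\ell,m\}}\mu(a)^2\mu(\ell)\mu(m)-8\sum_{a,\ell}\mu(a)^3\mu(\ell)+24\mu(i)\sum_{(a,b)}\mu(a)\mu(b)^2\\ &-8\sum_{(\ell,m)}\mu(\ell)^3\mu(m)-24\sum_{\{\ell,m\}}\mu(\ell)^2\mu(m)^2-44\sum_{\ell,\{m,p\}}\mu(\ell)^2\mu(m)\mu(p)-96\sum_{\{\ell,m,p,s\}}\mu(\ell)\mu(m)\mu(p)\mu(s).\end{aligned}$$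 Here $\{\cdot\}$ denotes unordered and $(\cdot,\cdot)$ ordered choices of distinct indices. *)

theory Defs
  imports "HOL-Probability.Probability" "HOL-Library.Ramsey"
begin

section \<open>Hypergraphs\<close>

definition hypergraph :: "'a set \<Rightarrow> 'a set set \<Rightarrow> bool" where
  "hypergraph V H \<longleftrightarrow> finite V \<and> finite H \<and> \<Union>H = V"

definition complete_3_uniform :: "'a set \<Rightarrow> 'a set set \<Rightarrow> bool" where
  "complete_3_uniform V H \<longleftrightarrow> hypergraph V H \<and> H = nsets V 3"

definition transversal :: "'a set \<Rightarrow> 'a set set \<Rightarrow> 'a set \<Rightarrow> bool" where
  "transversal V H T \<longleftrightarrow> T \<subseteq> V \<and> (\<forall>S\<in>H. T \<inter> S \<noteq> {})"


section \<open>Markov chains on a discrete state space\<close>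

text \<open>
  A transition kernel is a function \<open>K :: 's \<Rightarrow> 's pmf\<close>. The law of the whole trajectory of the
  chain started at \<open>x\<close>, a measure on \<open>nat \<Rightarrow> 's\<close>, is given by the Ionescu-Tulcea theorem:
  coordinate \<open>0\<close> is \<open>x\<close>, and coordinate \<open>Suc n\<close> has conditional law \<open>K\<close> of coordinate \<open>n\<close>.
\<close>

definition traj_kernel :: "('s \<Rightarrow> 's pmf) \<Rightarrow> 's \<Rightarrow> nat \<Rightarrow> (nat \<Rightarrow> 's) \<Rightarrow> 's measure" where
  "traj_kernel K x n \<omega> = measure_pmf (case n of 0 \<Rightarrow> return_pmf x | Suc m \<Rightarrow> K (\<omega> m))"

definition chain_law :: "('s \<Rightarrow> 's pmf) \<Rightarrow> 's \<Rightarrow> (nat \<Rightarrow> 's) measure" where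
  "chain_law K x =
     projective_family.lim UNIV
       (Ionescu_Tulcea.CI (traj_kernel K x) (\<lambda>_. count_space UNIV)) (\<lambda>_. count_space UNIV)"

lemma Ionescu_Tulcea_traj_kernel:
  "Ionescu_Tulcea (traj_kernel K x) (\<lambda>_. count_space UNIV)"
proof (rule Ionescu_Tulcea.intro)
  fix i :: nat
  show "traj_kernel K x i \<in> PiM {0..<i} (\<lambda>_. count_space UNIV) \<rightarrow>\<^sub>M subprob_algebra (count_space UNIV)"
  proof (cases i)
    case 0
    then have "traj_kernel K x i = (\<lambda>_. measure_pmf (return_pmf x))"
      by (simp add: traj_kernel_def fun_eq_iff)
    then show ?thesis
      using measurable_const[OF measure_pmf_in_subprob_algebra] by simp
  next
    case (Suc m)
    have "(\<lambda>s. measure_pmf (K s)) \<in> count_space UNIV \<rightarrow>\<^sub>M subprob_algebra (count_space UNIV)"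
      by (simp add: measure_pmf_in_subprob_algebra)
    moreover have "(\<lambda>\<omega>. \<omega> m) \<in> PiM {0..<i} (\<lambda>_. count_space UNIV) \<rightarrow>\<^sub>M count_space UNIV"
      using Suc by (intro measurable_component_singleton) auto
    ultimately have "(\<lambda>\<omega>. measure_pmf (K (\<omega> m)))
        \<in> PiM {0..<i} (\<lambda>_. count_space UNIV) \<rightarrow>\<^sub>M subprob_algebra (count_space UNIV)"
      by (rule measurable_compose[rotated])
    moreover have "traj_kernel K x i = (\<lambda>\<omega>. measure_pmf (K (\<omega> m)))"
      using Suc by (simp add: traj_kernel_def fun_eq_iff)
    ultimately show ?thesis
      by simp
  qed
qed (simp add: traj_kernel_def prob_space_measure_pmf)

lemma
  shows prob_space_chain_law: "prob_space (chain_law K x)"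
    and sets_chain_law: "sets (chain_law K x) = sets (PiM UNIV (\<lambda>_. count_space UNIV))"
    and emeasure_chain_law_path:
      "emeasure (chain_law K x) {\<omega>. \<forall>i\<le>n. \<omega> i = s i} =
         ennreal (of_bool (s 0 = x) * (\<Prod>i<n. pmf (K (s i)) (s (Suc i))))"
proof -
  interpret Ionescu_Tulcea "traj_kernel K x" "\<lambda>_. count_space UNIV"
    by (rule Ionescu_Tulcea_traj_kernel)
  let ?M = "\<lambda>_::nat. count_space (UNIV :: 'a set)"
  have law: "chain_law K x = PF.lim"
    unfolding chain_law_def ..
  have emb: "PF.emb UNIV {} (space (PiM {} ?M)) = space PF.lim"
    by (auto simp: prod_emb_def space_PiM)
  have "emeasure PF.lim (space PF.lim) = emeasure (CI {}) (space (PiM {} ?M))"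
    unfolding emb[symmetric] by (rule lim) auto
  also have "\<dots> = 1"
  proof -
    interpret C: prob_space "CI {}"
      by (rule PF.prob_space_P) auto
    have "space (CI {}) = space (PiM {} ?M)"
      by (simp add: CI_def)
    then show ?thesis
      using C.emeasure_space_1 by simp
  qed
  finally show "prob_space (chain_law K x)"
    unfolding law by (rule prob_spaceI)
  show "sets (chain_law K x) = sets (PiM UNIV (\<lambda>_. count_space UNIV))"
    unfolding law by simp

  have sing: "{restrict s {0..<m}} \<in> sets (PiM {0..<m} ?M)" for m
  proof -
    have "PiE {0..<m} (\<lambda>i. {s i}) = PiE {0..<m} (\<lambda>i. {restrict s {0..<m} i})"
      by (rule PiE_cong) simp
    also have "\<dots> = {restrict s {0..<m}}"
      by (rule PiE_singleton) (rule restrict_extensional)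
    finally have "PiE {0..<m} (\<lambda>i. {s i}) = {restrict s {0..<m}}" .
    moreover have "PiE {0..<m} (\<lambda>i. {s i}) \<in> sets (PiM {0..<m} ?M)"
      by (rule sets_PiM_I_finite) auto
    ultimately show ?thesis by simp
  qed
  have u: "(\<lambda>_. undefined) \<in> space (PiM {0..<0} ?M)"
    by (simp add: space_PiM)
  define p where "p m = emeasure (C 0 m (\<lambda>_. undefined)) {restrict s {0..<m}}" for m
  have p_Suc: "p (Suc m) = emeasure (traj_kernel K x m s) {s m} * p m" for m
  proof -
    have kernel_cong: "traj_kernel K x m \<omega> = traj_kernel K x m s" if "\<omega> = restrict s {0..<m}" for \<omega>
      using that by (cases m) (auto simp: traj_kernel_def)
    have "p (Suc m) = (\<integral>\<^sup>+\<omega>. emeasure (eP m \<omega>) {restrict s {0..<Suc m}} \<partial>C 0 m (\<lambda>_. undefined))"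
      unfolding p_def C.simps add_0
    proof (rule emeasure_bind[OF _ _ sing])
      show "space (C 0 m (\<lambda>_. undefined)) \<noteq> {}"
        using prob_space.not_empty[OF prob_space_C[OF u]] .
      have "sets (C 0 m (\<lambda>_. undefined)) = sets (PiM {0..<m} ?M)"
        using sets_C[OF u, of m] by simp
      then show "eP m \<in> C 0 m (\<lambda>_. undefined) \<rightarrow>\<^sub>M subprob_algebra (PiM {0..<Suc m} ?M)"
        using measurable_eP[of m] by (simp cong: measurable_cong_sets)
    qed
    also have "\<dots> = (\<integral>\<^sup>+\<omega>. emeasure (traj_kernel K x m s) {s m} * indicator {restrict s {0..<m}} \<omega>
                      \<partial>C 0 m (\<lambda>_. undefined))"
    proof (rule nn_integral_cong)
      fix \<omega> assume "\<omega> \<in> space (C 0 m (\<lambda>_. undefined))"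
      then have \<omega>: "\<omega> \<in> space (PiM {0..<m} ?M)"
        using space_C[OF u, of m] by simp
      then have ext: "\<omega> \<in> extensional {0..<m}"
        by (auto simp: space_PiM PiE_def)
      have "(fun_upd \<omega> m -` {restrict s {0..<Suc m}}) =
              (if \<omega> = restrict s {0..<m} then {s m} else {})"
      proof -
        have "fun_upd \<omega> m y = restrict s {0..<Suc m} \<longleftrightarrow> \<omega> = restrict s {0..<m} \<and> y = s m" for y
        proof
          assume eq: "fun_upd \<omega> m y = restrict s {0..<Suc m}"
          have "\<omega> i = restrict s {0..<m} i" for i
            using fun_cong[OF eq, of i] ext by (cases "i = m") (auto simp: extensional_def restrict_def split: if_splits)
          moreover have "y = s m"
            using fun_cong[OF eq, of m] by simp
          ultimately show "\<omega> = restrict s {0..<m} \<and> y = s m"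
            by blast
        qed (auto simp: restrict_def fun_eq_iff)
        then show ?thesis by auto
      qed
      then show "emeasure (eP m \<omega>) {restrict s {0..<Suc m}} =
          emeasure (traj_kernel K x m s) {s m} * indicator {restrict s {0..<m}} \<omega>"
        using emeasure_eP[OF \<omega> sing[of "Suc m"]] kernel_cong[of \<omega>] by auto
    qed
    also have "\<dots> = emeasure (traj_kernel K x m s) {s m} * p m"
      unfolding p_def using sing[of m] sets_C[OF u, of m]
      by (subst nn_integral_cmult_indicator) auto
    finally show ?thesis .
  qed
  have p_0: "p 0 = 1"
    using sing[of 0] by (simp add: p_def restrict_def emeasure_return)
  have p: "p (Suc m) = ennreal (of_bool (s 0 = x) * (\<Prod>i<m. pmf (K (s i)) (s (Suc i))))" for m
  proof (induction m)
    case 0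
    then show ?case
      by (auto simp: p_Suc p_0 traj_kernel_def emeasure_pmf_single)
  next
    case (Suc m)
    have "p (Suc (Suc m)) = ennreal (pmf (K (s m)) (s (Suc m))) * p (Suc m)"
      unfolding p_Suc[of "Suc m"] by (simp only: traj_kernel_def nat.case emeasure_pmf_single)
    also have "\<dots> = ennreal (pmf (K (s m)) (s (Suc m)) *
        (of_bool (s 0 = x) * (\<Prod>i<m. pmf (K (s i)) (s (Suc i)))))"
      unfolding Suc by (rule ennreal_mult[symmetric]) (simp_all add: prod_nonneg)
    also have "pmf (K (s m)) (s (Suc m)) * (of_bool (s 0 = x) * (\<Prod>i<m. pmf (K (s i)) (s (Suc i)))) =
        of_bool (s 0 = x) * (\<Prod>i<Suc m. pmf (K (s i)) (s (Suc i)))"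
      by (simp only: prod.lessThan_Suc mult_ac)
    finally show ?case .
  qed
  have "{\<omega>. \<forall>i\<le>n. \<omega> i = s i} = PF.emb UNIV {0..<Suc n} {restrict s {0..<Suc n}}"
    by (auto simp: prod_emb_def space_PiM fun_eq_iff restrict_def less_Suc_eq_le) metis
  then have "emeasure (chain_law K x) {\<omega>. \<forall>i\<le>n. \<omega> i = s i} =
      emeasure (CI {0..<Suc n}) {restrict s {0..<Suc n}}"
    unfolding law using lim[OF _ sing[of "Suc n"]] by simp
  also have "\<dots> = p (Suc n)"
    unfolding p_def using sing[of "Suc n"]
    by (subst emeasure_CI[where n="Suc n"]) (auto simp: prod_emb_id sets.sets_into_space)
  finally show "emeasure (chain_law K x) {\<omega>. \<forall>i\<le>n. \<omega> i = s i} =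
      ennreal (of_bool (s 0 = x) * (\<Prod>i<n. pmf (K (s i)) (s (Suc i))))"
    unfolding p .
qed

text \<open>The first return time is \<open>\<infinity>\<close> (the infimum of the empty set) if the trajectory never returns.\<close>

definition return_time :: "'s \<Rightarrow> (nat \<Rightarrow> 's) \<Rightarrow> ennreal" where
  "return_time x \<omega> = (INF n\<in>{n. 1 \<le> n \<and> \<omega> n = x}. of_nat n)"

definition positive_recurrent :: "('s \<Rightarrow> 's pmf) \<Rightarrow> 's set \<Rightarrow> bool" where
  "positive_recurrent K S \<longleftrightarrow> (\<forall>x\<in>S. (\<integral>\<^sup>+\<omega>. return_time x \<omega> \<partial>chain_law K x) < \<infinity>)"


section \<open>Matching models\<close>

text \<open>
  The state of the model is the word of classes of the stored items, oldest first.
  \<open>matches H w v\<close> are the hyperedges that an incoming item of class \<open>v\<close> can complete with the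
  buffer \<open>w\<close>. A policy selects, possibly at random, one of them; the oldest item of each
  other class of the selected hyperedge then leaves together with the incoming item.
\<close>

definition matches :: "'a set set \<Rightarrow> 'a list \<Rightarrow> 'a \<Rightarrow> 'a set set" where
  "matches H w v = {S \<in> H. v \<in> S \<and> S - {v} \<subseteq> set w}"

type_synonym 'a policy = "'a set set \<Rightarrow> 'a list \<Rightarrow> 'a \<Rightarrow> 'a set pmf"

fun remove_oldest :: "'a set \<Rightarrow> 'a list \<Rightarrow> 'a list" where
  "remove_oldest A [] = []"
| "remove_oldest A (c # w) =
     (if c \<in> A then remove_oldest (A - {c}) w else c # remove_oldest A w)"

definition matching_step :: "'a set set \<Rightarrow> 'a policy \<Rightarrow> 'a pmf \<Rightarrow> 'a list \<Rightarrow> 'a list pmf" where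
  "matching_step H \<Phi> \<mu> w =
     bind_pmf \<mu> (\<lambda>v.
       if matches H w v = {} then return_pmf (w @ [v])
       else map_pmf (\<lambda>S. remove_oldest (S - {v}) w) (\<Phi> H w v))"

text \<open>
  The state space: words whose classes contain no hyperedge. These are exactly the words
  reachable from the empty buffer, by letting their letters arrive in order.
\<close>

definition buffer_words :: "'a set \<Rightarrow> 'a set set \<Rightarrow> 'a list set" where
  "buffer_words V H = {w \<in> lists V. \<forall>S\<in>H. \<not> S \<subseteq> set w}"

definition model_stable :: "'a set \<Rightarrow> 'a set set \<Rightarrow> 'a policy \<Rightarrow> 'a pmf \<Rightarrow> bool" where
  "model_stable V H \<Phi> \<mu> \<longleftrightarrow> positive_recurrent (matching_step H \<Phi> \<mu>) (buffer_words V H)"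

text \<open>\<open>count_list w i\<close> is the number of stored items of class \<open>i\<close>; ties are broken uniformly.\<close>

definition match_the_longest :: "'a policy" where
  "match_the_longest H w v =
     pmf_of_set {S. is_arg_max (\<lambda>S. \<Sum>i\<in>S. count_list w i) (\<lambda>S. S \<in> matches H w v) S}"


section \<open>The drift polynomials\<close>

text \<open>
  Sums over unordered choices of \<open>n\<close> distinct indices in \<open>A\<close> are sums over \<open>nsets A n\<close>;
  \<open>esym m A n\<close> is the elementary symmetric polynomial of degree \<open>n\<close> in \<open>(m x)\<close>, \<open>x \<in> A\<close>.
\<close>

definition esym :: "('a \<Rightarrow> real) \<Rightarrow> 'a set \<Rightarrow> nat \<Rightarrow> real" where
  "esym m A n = (\<Sum>P\<in>nsets A n. \<Prod>x\<in>P. m x)"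

definition lambda_poly :: "'a set \<Rightarrow> ('a \<Rightarrow> real) \<Rightarrow> 'a \<Rightarrow> real" where
  "lambda_poly V m i = (let U = V - {i} in
       8 * m i ^ 4
     + 24 * m i ^ 3 * (\<Sum>j\<in>U. m j)
     + 24 * m i ^ 2 * (\<Sum>j\<in>U. m j ^ 2)
     + 8 * m i * (\<Sum>j\<in>U. m j ^ 3)
     + 24 * m i ^ 2 * esym m U 2
     - 44 * (\<Sum>j\<in>U. m j ^ 2 * esym m (U - {j}) 2)
     - 24 * esym (\<lambda>x. m x ^ 2) U 2
     - 8 * (\<Sum>j\<in>U. \<Sum>k\<in>U - {j}. m j * m k ^ 3)
     - 96 * esym m U 4)"

text \<open>
  Here \<open>H = {i, j, k}\<close> is the removed hyperedge containing \<open>i\<close>; \<open>A = {j, k}\<close>, so that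
  \<open>\<Prod>a\<in>A. m a\<close> is the product \<open>m j * m k\<close>; and \<open>L\<close> is the complement of \<open>H\<close>.
\<close>

definition nu_poly :: "'a set \<Rightarrow> 'a set \<Rightarrow> ('a \<Rightarrow> real) \<Rightarrow> 'a \<Rightarrow> real" where
  "nu_poly V H m i = (let U = V - {i}; A = H - {i}; L = V - H in
       8 * m i ^ 4
     + 24 * m i ^ 3 * (\<Sum>u\<in>U. m u)
     + 24 * m i ^ 2 * (\<Sum>u\<in>U. m u ^ 2)
     + 8 * m i * (\<Sum>u\<in>U. m u ^ 3)
     - 8 * (\<Sum>a\<in>A. \<Sum>l\<in>L. m a * m l ^ 3)
     - 24 * (\<Sum>a\<in>A. \<Sum>b\<in>A - {a}. \<Sum>l\<in>L. m a * m b ^ 2 * m l)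
     - 48 * (\<Prod>a\<in>A. m a) * (\<Sum>l\<in>L. m l ^ 2)
     - 44 * (\<Sum>a\<in>A. \<Sum>l\<in>L. \<Sum>p\<in>L - {l}. m a * m l ^ 2 * m p)
     + 48 * m i ^ 2 * (\<Prod>a\<in>A. m a)
     - 88 * (\<Prod>a\<in>A. m a) * esym m L 2
     - 96 * (\<Sum>a\<in>A. m a * esym m L 3)
     + 24 * m i ^ 2 * (\<Sum>a\<in>A. \<Sum>l\<in>L. m a * m l)
     + 24 * m i ^ 2 * esym m L 2
     - 24 * (\<Sum>a\<in>A. \<Sum>l\<in>L. m a ^ 2 * m l ^ 2)
     - 44 * (\<Sum>a\<in>A. m a ^ 2 * esym m L 2)
     - 8 * (\<Sum>a\<in>A. \<Sum>l\<in>L. m a ^ 3 * m l)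
     + 24 * m i * (\<Sum>a\<in>A. \<Sum>b\<in>A - {a}. m a * m b ^ 2)
     - 8 * (\<Sum>l\<in>L. \<Sum>p\<in>L - {l}. m l ^ 3 * m p)
     - 24 * esym (\<lambda>x. m x ^ 2) L 2
     - 44 * (\<Sum>l\<in>L. m l ^ 2 * esym m (L - {l}) 2)
     - 96 * esym m L 4)"

end

theory Submission
  imports Defs
begin

text \<open>
  Write \<open>x(c)\<close> for the number of stored items of class \<open>c\<close> and \<open>n\<close> for the length of the buffer. The
  proof exhibits a function whose expected one-step change is at most \<open>3 - d * n\<close> for some
  \<open>d > 0\<close>, and applies the criterion of Foster.

  Two members of \<open>J\<close> never share a pair of classes, so a buffer holds at most two classes or exactly
  the three classes of some \<open>T \<in> J\<close> (\<open>buffer_classes\<close>). Consider \<open>h\<^sub>c = x(c) - (\<Sum>c' \<noteq> c. x(c')) / 2\<close>.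
  When the arriving item has class \<open>c\<close>, \<open>h\<^sub>c\<close> grows by \<open>1\<close>, whether the item is stored or completes a
  pair of other classes; when it has another class, \<open>h\<^sub>c\<close> drops by \<open>1/2\<close>, whether the item is stored
  or is matched with one item of class \<open>c\<close>. Hence, as long as the matches involve \<open>c\<close>, the drift of
  \<open>h\<^sub>c\<close> is \<open>(3 * \<mu>(c) - 1) / 2\<close>, which is negative by the bound on single classes. The quadratic form
  whose gradient is \<open>2 * h\<close> is \<open>Q = (3 * (\<Sum>c. x(c)\<^sup>2) - n\<^sup>2) / 2\<close>, and it decreases in mean when at
  most two classes are present.

  On a triple \<open>T \<in> J\<close> the form \<open>Q\<close> is half the sum of the squared differences of the three counts.
  Matching the longest never increases its mean to first order, but \<open>Q\<close> cannot see a buffer in which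
  the three counts are equal. Adding \<open>e * n\<^sup>2\<close> with a small \<open>e > 0\<close> repairs this: an arrival from \<open>T\<close>
  adds one item and any other arrival removes two, so \<open>n\<close> has drift \<open>3 * \<mu>(T) - 2\<close>. The
  complement of \<open>T\<close> is a transversal, whence \<open>\<mu>(T) < 2/3\<close> and this drift is negative. The sum
  \<open>Q + e * n\<^sup>2\<close> is the function \<open>energy\<close>, and its drift is computed in \<open>energy_drift\<close>.

  Foster's criterion is proved here for chains with finitely supported transitions
  (\<open>foster_criterion\<close>) by constructing a function that bounds all expected return times.
\<close>

section \<open>Return times and Foster's criterion\<close>

text \<open>
  The probability that the chain started at \<open>y\<close> is not at \<open>x\<close> at any of the times \<open>1, \<dots>, n\<close>, given by
  first-step analysis so that it can be compared with superharmonic functions;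
  \<open>emeasure_chain_law_avoid_le\<close> relates it to the law of the trajectory.
\<close>

primrec avoid :: "('s \<Rightarrow> 's pmf) \<Rightarrow> 's \<Rightarrow> nat \<Rightarrow> 's \<Rightarrow> real" where
  "avoid K x 0 y = 1"
| "avoid K x (Suc n) y =
     measure_pmf.expectation (K y) (\<lambda>z. if z = x then 0 else avoid K x n z)"

text \<open>
  The law of the first \<open>n + 1\<close> states. It mediates between the step-by-step recursion of
  \<open>avoid\<close> and the path probabilities that determine \<open>chain_law\<close>.
\<close>

primrec path_pmf :: "('s \<Rightarrow> 's pmf) \<Rightarrow> nat \<Rightarrow> 's \<Rightarrow> 's list pmf" where
  "path_pmf K 0 y = return_pmf [y]"
| "path_pmf K (Suc n) y = bind_pmf (K y) (\<lambda>z. map_pmf ((#) y) (path_pmf K n z))"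

lemma set_path_pmfD: "l \<in> set_pmf (path_pmf K n y) \<Longrightarrow> length l = Suc n \<and> hd l = y"
  by (induction n arbitrary: y l) auto

lemma finite_set_path_pmf:
  assumes "\<And>y. finite (set_pmf (K y))"
  shows "finite (set_pmf (path_pmf K n y))"
  using assms by (induction n arbitrary: y) auto

lemma pmf_path_pmf:
  "length l = Suc n \<Longrightarrow> hd l = y \<Longrightarrow>
     pmf (path_pmf K n y) l = (\<Prod>i<n. pmf (K (l ! i)) (l ! Suc i))"
proof (induction n arbitrary: y l)
  case 0
  then show ?case by (cases l) auto
next
  case (Suc n)
  obtain l' where l: "l = y # l'" "length l' = Suc n"
    using Suc.prems by (cases l) auto
  let ?c = "\<Prod>i<n. pmf (K (l' ! i)) (l' ! Suc i)"
  have "pmf (map_pmf ((#) y) (path_pmf K n z)) l = indicator {hd l'} z * ?c" for z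
  proof (cases "z = hd l'")
    case True
    then show ?thesis
      using Suc.IH[of l' z] l by (simp add: pmf_map_inj')
  next
    case False
    then have "l' \<notin> set_pmf (path_pmf K n z)"
      using set_path_pmfD by metis
    then show ?thesis
      using False l by (simp add: pmf_map_inj' pmf_eq_0_set_pmf)
  qed
  then have "pmf (path_pmf K (Suc n) y) l = pmf (K y) (hd l') * ?c"
    by (simp add: pmf_bind measure_pmf_single)
  also have "\<dots> = (\<Prod>i<Suc n. pmf (K (l ! i)) (l ! Suc i))"
    using l by (subst prod.lessThan_Suc_shift) (cases l', auto)
  finally show ?case .
qed

lemma prob_path_pmf_avoid:
  assumes fin: "\<And>y. finite (set_pmf (K y))"
  shows "measure_pmf.prob (path_pmf K n y) {l. x \<notin> set (tl l)} = avoid K x n y"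
proof (induction n arbitrary: y)
  case 0
  then show ?case by (simp add: measure_return)
next
  case (Suc n)
  have step: "measure_pmf.prob (map_pmf ((#) y) (path_pmf K n z)) {l. x \<notin> set (tl l)} =
      (if z = x then 0 else avoid K x n z)" for z
  proof -
    have "measure_pmf.prob (map_pmf ((#) y) (path_pmf K n z)) {l. x \<notin> set (tl l)} =
        measure_pmf.prob (path_pmf K n z) {l. x \<notin> set l}"
      by (simp add: vimage_def)
    also have "\<dots> = measure_pmf.prob (path_pmf K n z) {l. z \<noteq> x \<and> x \<notin> set (tl l)}"
    proof (rule measure_pmf.finite_measure_eq_AE)
      have "x \<notin> set l \<longleftrightarrow> z \<noteq> x \<and> x \<notin> set (tl l)" if "l \<in> set_pmf (path_pmf K n z)" for l
        using set_path_pmfD[OF that] by (cases l) auto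
      then show "AE l in path_pmf K n z. l \<in> {l. x \<notin> set l} \<longleftrightarrow> l \<in> {l. z \<noteq> x \<and> x \<notin> set (tl l)}"
        by (simp add: AE_measure_pmf_iff)
    qed auto
    finally show ?thesis
      using Suc.IH[of z] by (cases "z = x") auto
  qed
  have "measure_pmf.prob (path_pmf K (Suc n) y) {l. x \<notin> set (tl l)} =
      measure_pmf.expectation (path_pmf K (Suc n) y) (indicat_real {l. x \<notin> set (tl l)})"
    by simp
  also have "\<dots> = (\<Sum>z\<in>set_pmf (K y). pmf (K y) z *
      measure_pmf.expectation (map_pmf ((#) y) (path_pmf K n z)) (indicat_real {l. x \<notin> set (tl l)}))"
    unfolding path_pmf.simps
    by (subst pmf_expectation_bind[of "set_pmf (K y)"]) (auto simp: fin finite_set_path_pmf)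
  also have "\<dots> = (\<Sum>z\<in>set_pmf (K y). pmf (K y) z * (if z = x then 0 else avoid K x n z))"
    using step by simp
  also have "\<dots> = avoid K x (Suc n) y"
    unfolding avoid.simps by (subst integral_measure_pmf[of "set_pmf (K y)"]) (auto simp: fin)
  finally show ?case .
qed

lemma space_chain_law: "space (chain_law K y) = UNIV"
  using sets_eq_imp_space_eq[OF sets_chain_law[of K y]] by (simp add: space_PiM PiE_UNIV_domain)

lemma sets_coordinate_event:
  "finite I \<Longrightarrow> {\<omega>. \<forall>i\<in>I. \<omega> i \<in> B i} \<in> sets (chain_law K y)"
proof (induction I rule: finite_induct)
  case empty
  then show ?case using sets.top[of "chain_law K y"] by (simp add: space_chain_law)
next
  case (insert i I)
  have "(\<lambda>\<omega>. \<omega> i) \<in> chain_law K y \<rightarrow>\<^sub>M count_space UNIV"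
    unfolding measurable_cong_sets[OF sets_chain_law refl]
    by (rule measurable_component_singleton) simp
  then have "{\<omega>. \<omega> i \<in> B i} \<in> sets (chain_law K y)"
    using measurable_sets[of "\<lambda>\<omega>. \<omega> i" "chain_law K y" "count_space UNIV" "B i"]
    by (simp add: space_chain_law vimage_def)
  from sets.Int[OF this insert.IH] show ?case
    by (simp add: Collect_conj_eq[symmetric])
qed

text \<open>
  Trajectories that hit \<open>x\<close> by time \<open>n\<close> include the finite disjoint union of the cylinders over the
  possible paths through \<open>x\<close>, and this union already has probability \<open>1 - avoid K x n y\<close>. Working with the
  complement keeps every union finite, although the state space may be uncountable.
\<close>

lemma emeasure_chain_law_avoid_le:
  assumes fin: "\<And>y. finite (set_pmf (K y))"
  shows "emeasure (chain_law K y) {\<omega>. \<forall>i\<in>{1..n}. \<omega> i \<noteq> x} \<le> ennreal (avoid K x n y)"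
proof -
  let ?M = "chain_law K y"
  interpret prob_space ?M by (rule prob_space_chain_law)
  define B where "B = {l \<in> set_pmf (path_pmf K n y). x \<in> set (tl l)}"
  define cyl where "cyl l = {\<omega>. \<forall>i\<le>n. \<omega> i = l ! i}" for l :: "'a list"
  have B: "length l = Suc n \<and> hd l = y" if "l \<in> B" for l
    using that by (auto simp: B_def dest: set_path_pmfD)
  have finB: "finite B"
    unfolding B_def using finite_set_path_pmf[of K, OF fin] by simp
  have meas: "cyl l \<in> sets ?M" for l
  proof -
    have "cyl l = {\<omega>. \<forall>i\<in>{..n}. \<omega> i \<in> {l ! i}}" by (auto simp: cyl_def)
    then show ?thesis using sets_coordinate_event[of "{..n}" "\<lambda>i. {l ! i}"] by simp
  qed
  \<comment> \<open>Paths in \<open>B\<close> all have length \<open>n + 1\<close>, so distinct ones differ at a time up to \<open>n\<close>.\<close>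
  have "disjoint_family_on cyl B"
  proof (unfold disjoint_family_on_def, intro ballI impI)
    fix l l' assume ll: "l \<in> B" "l' \<in> B" "l \<noteq> l'"
    then obtain i where "i \<le> n" "l ! i \<noteq> l' ! i"
      using B by (metis nth_equalityI less_Suc_eq_le)
    then show "cyl l \<inter> cyl l' = {}"
      by (auto simp: cyl_def)
  qed
  then have "measure ?M (\<Union>l\<in>B. cyl l) = (\<Sum>l\<in>B. measure ?M (cyl l))"
    using finB meas by (intro finite_measure_finite_Union) auto
  also have "\<dots> = (\<Sum>l\<in>B. pmf (path_pmf K n y) l)"
  proof (rule sum.cong[OF refl])
    fix l assume l: "l \<in> B"
    then have "l ! 0 = y"
      using B[OF l] by (cases l) auto
    then have "emeasure ?M (cyl l) = ennreal (pmf (path_pmf K n y) l)"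
      unfolding cyl_def emeasure_chain_law_path using B[OF l] by (simp add: pmf_path_pmf)
    then show "measure ?M (cyl l) = pmf (path_pmf K n y) l"
      by (simp add: measure_def)
  qed
  also have "\<dots> = measure_pmf.prob (path_pmf K n y) B"
    by (rule measure_measure_pmf_finite[OF finB, symmetric])
  also have "\<dots> = measure_pmf.prob (path_pmf K n y) (UNIV - {l. x \<notin> set (tl l)})"
    by (rule measure_pmf.finite_measure_eq_AE) (auto simp: B_def AE_measure_pmf_iff)
  also have "\<dots> = 1 - avoid K x n y"
    using measure_pmf.prob_compl[of "{l. x \<notin> set (tl l)}" "path_pmf K n y"]
    by (simp add: prob_path_pmf_avoid[of K, OF fin])
  finally have hit: "measure ?M (\<Union>l\<in>B. cyl l) = 1 - avoid K x n y" .
  have "{\<omega>. \<forall>i\<in>{1..n}. \<omega> i \<noteq> x} \<subseteq> space ?M - (\<Union>l\<in>B. cyl l)"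
  proof -
    have "\<exists>i\<in>{1..n}. \<omega> i = x" if "l \<in> B" "\<omega> \<in> cyl l" for l \<omega>
    proof -
      have "x \<in> set (tl l)"
        using that(1) by (simp add: B_def)
      then obtain i where i: "i < length (tl l)" "tl l ! i = x"
        by (metis in_set_conv_nth)
      then have "Suc i \<le> n" "l ! Suc i = x"
        using B[OF that(1)] by (auto simp: nth_tl)
      then show ?thesis
        using that(2) by (intro bexI[of _ "Suc i"]) (auto simp: cyl_def)
    qed
    then show ?thesis by (fastforce simp: space_chain_law)
  qed
  moreover have U: "(\<Union>l\<in>B. cyl l) \<in> sets ?M"
    using finB meas by auto
  ultimately have "measure ?M {\<omega>. \<forall>i\<in>{1..n}. \<omega> i \<noteq> x} \<le> measure ?M (space ?M - (\<Union>l\<in>B. cyl l))"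
    by (intro finite_measure_mono) auto
  also have "\<dots> = avoid K x n y"
    using prob_compl[OF U] hit by simp
  finally show ?thesis
    by (simp add: emeasure_eq_measure ennreal_leI)
qed

text \<open>
  The layer-cake decomposition: a return time \<open>t\<close> is the number of \<open>n < t\<close>, and these are the \<open>n\<close> for which
  no return has happened by time \<open>n\<close>.
\<close>

lemma return_time_le_suminf:
  "return_time x \<omega> \<le> (\<Sum>n. indicator {\<omega>. \<forall>i\<in>{1..n}. \<omega> i \<noteq> x} \<omega>)"
    (is "_ \<le> (\<Sum>n. ?f n)")
proof (cases "\<exists>t\<ge>1. \<omega> t = x")
  case True
  define t where "t = (LEAST t. 1 \<le> t \<and> \<omega> t = x)"
  have t: "1 \<le> t" "\<omega> t = x" "\<And>i. 1 \<le> i \<Longrightarrow> i < t \<Longrightarrow> \<omega> i \<noteq> x"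
    unfolding t_def using LeastI_ex[OF True] not_less_Least by blast+
  have "return_time x \<omega> \<le> of_nat t"
    unfolding return_time_def using t by (intro INF_lower) auto
  also have "\<dots> = (\<Sum>n<t. ?f n)"
    using t(3) by (simp add: indicator_def)
  also have "\<dots> \<le> (\<Sum>n. ?f n)"
    by (rule sum_le_suminf) auto
  finally show ?thesis .
next
  case False
  then have f: "?f n = 1" for n
    by (auto simp: indicator_def)
  have "(\<Sum>n. ?f n) = \<infinity>"
  proof (rule ccontr)
    assume "(\<Sum>n. ?f n) \<noteq> \<infinity>"
    then obtain N where "(\<Sum>n. ?f n) < of_nat N"
      using ennreal_Ex_less_of_nat by (auto simp: less_top)
    moreover have "of_nat N = (\<Sum>n<N. ?f n)"
      using f by simp
    moreover have "\<dots> \<le> (\<Sum>n. ?f n)"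
      by (rule sum_le_suminf) auto
    ultimately show False by (simp add: not_less[symmetric])
  qed
  then show ?thesis by simp
qed

lemma expected_return_time_le:
  assumes fin: "\<And>y. finite (set_pmf (K y))"
  shows "(\<integral>\<^sup>+\<omega>. return_time x \<omega> \<partial>chain_law K y) \<le> (\<Sum>n. ennreal (avoid K x n y))"
proof -
  have meas: "{\<omega>. \<forall>i\<in>{1..n}. \<omega> i \<noteq> x} \<in> sets (chain_law K y)" for n
    using sets_coordinate_event[of "{1..n}" "\<lambda>_. - {x}"] by simp
  have "(\<integral>\<^sup>+\<omega>. return_time x \<omega> \<partial>chain_law K y)
      \<le> (\<integral>\<^sup>+\<omega>. (\<Sum>n. indicator {\<omega>. \<forall>i\<in>{1..n}. \<omega> i \<noteq> x} \<omega>) \<partial>chain_law K y)"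
    by (intro nn_integral_mono return_time_le_suminf)
  also have "\<dots> = (\<Sum>n. emeasure (chain_law K y) {\<omega>. \<forall>i\<in>{1..n}. \<omega> i \<noteq> x})"
    by (subst nn_integral_suminf) (use meas in \<open>auto simp del: One_nat_def\<close>)
  also have "\<dots> \<le> (\<Sum>n. ennreal (avoid K x n y))"
    by (intro suminf_le emeasure_chain_law_avoid_le fin) auto
  finally show ?thesis .
qed

lemma avoid_bounds:
  assumes fin: "\<And>y. finite (set_pmf (K y))"
  shows "0 \<le> avoid K x n y" "avoid K x n y \<le> 1"
  using prob_path_pmf_avoid[of K n y x, OF fin] by (metis measure_nonneg, metis measure_pmf.prob_le_1)

lemma expectation_mono_finite:
  fixes f g :: "'s \<Rightarrow> real"
  assumes "finite (set_pmf p)" "\<And>z. z \<in> set_pmf p \<Longrightarrow> f z \<le> g z"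
  shows "measure_pmf.expectation p f \<le> measure_pmf.expectation p g"
  using assms by (intro integral_mono_AE) (auto simp: integrable_measure_pmf_finite AE_measure_pmf_iff)

lemma avoid_Suc_le:
  assumes fin: "\<And>y. finite (set_pmf (K y))"
  shows "avoid K x (Suc n) y \<le> avoid K x n y"
proof (induction n arbitrary: y)
  case 0
  then show ?case using avoid_bounds(2)[of K x "Suc 0" y, OF fin] by simp
next
  case (Suc n)
  show ?case
    unfolding avoid.simps(2)[of K x "Suc n"] avoid.simps(2)[of K x n]
    by (intro expectation_mono_finite fin) (use Suc in auto)
qed

text \<open>
  The path must have at least one step, because \<open>avoid\<close> disregards the time \<open>0\<close>.
\<close>

lemma avoid_less_1:
  assumes fin: "\<And>y. finite (set_pmf (K y))"
    and reach: "(y, x) \<in> {(a, b). b \<in> set_pmf (K a)}\<^sup>+"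
  shows "\<exists>n. avoid K x n y < 1"
proof -
  have one_step: "avoid K x (Suc n) a < 1"
    if z: "z \<in> set_pmf (K a)" and less: "z = x \<or> avoid K x n z < 1" for a z n
  proof -
    let ?g = "\<lambda>z. if z = x then 0 else avoid K x n z"
    have "avoid K x (Suc n) a = (\<Sum>z\<in>set_pmf (K a). pmf (K a) z * ?g z)"
      unfolding avoid.simps by (subst integral_measure_pmf[of "set_pmf (K a)"]) (auto simp: fin)
    also have "\<dots> < (\<Sum>z\<in>set_pmf (K a). pmf (K a) z)"
    proof (rule sum_strict_mono_ex1)
      show "\<forall>z\<in>set_pmf (K a). pmf (K a) z * ?g z \<le> pmf (K a) z"
        using avoid_bounds[of K x n, OF fin] by (auto intro!: mult_left_le)
      show "\<exists>z\<in>set_pmf (K a). pmf (K a) z * ?g z < pmf (K a) z"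
        using z less pmf_positive[OF z] by (intro bexI[of _ z]) auto
    qed (rule fin)
    also have "\<dots> = 1" by (rule sum_pmf_eq_1) (auto simp: fin)
    finally show ?thesis .
  qed
  from reach show ?thesis
  proof (induction rule: converse_trancl_induct)
    case (base a)
    then show ?case using one_step[of x a 0] by blast
  next
    case (step a z)
    then show ?case using one_step[of z a] by blast
  qed
qed

text \<open>
  The expected hitting time is the least nonnegative solution of a first-step inequality; so any
  solution \<open>g\<close> dominates it, as seen by comparing \<open>g\<close> with the partial sums, one step at a time.
\<close>

lemma suminf_avoid_finite:
  fixes g :: "'s \<Rightarrow> real"
  assumes fin: "\<And>y. finite (set_pmf (K y))"
    and closed: "\<And>y. y \<in> S \<Longrightarrow> set_pmf (K y) \<subseteq> S"
    and nonneg: "\<And>y. y \<in> S \<Longrightarrow> 0 \<le> g y"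
    and super: "\<And>y. y \<in> S \<Longrightarrow>
      measure_pmf.expectation (K y) (\<lambda>z. if z = x then 0 else g z) \<le> g y - 1"
    and y: "y \<in> S"
  shows "(\<Sum>n. ennreal (avoid K x n y)) < \<infinity>"
proof -
  have partial: "(\<Sum>n<N. avoid K x n y) \<le> g y" if "y \<in> S" for N y
    using that
  proof (induction N arbitrary: y)
    case 0
    then show ?case using nonneg by simp
  next
    case (Suc N)
    have "(\<Sum>n<N. avoid K x (Suc n) y) =
        measure_pmf.expectation (K y) (\<lambda>z. \<Sum>n<N. if z = x then 0 else avoid K x n z)"
      by (simp add: integrable_measure_pmf_finite[OF fin])
    also have "\<dots> \<le> measure_pmf.expectation (K y) (\<lambda>z. if z = x then 0 else g z)"
      using closed[OF Suc.prems] Suc.IH by (intro expectation_mono_finite fin) auto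
    also have "\<dots> \<le> g y - 1" by (rule super[OF Suc.prems])
    finally show ?case by (subst sum.lessThan_Suc_shift) simp
  qed
  have "(\<Sum>n. ennreal (avoid K x n y)) \<le> ennreal (g y)"
  proof (rule suminf_le_const[OF summableI])
    fix N
    have "(\<Sum>n<N. ennreal (avoid K x n y)) = ennreal (\<Sum>n<N. avoid K x n y)"
      using avoid_bounds[of K x _ y, OF fin] by (simp add: sum_ennreal)
    also have "\<dots> \<le> ennreal (g y)"
      using partial[OF y] by (rule ennreal_leI)
    finally show "(\<Sum>n<N. ennreal (avoid K x n y)) \<le> ennreal (g y)" .
  qed
  also have "\<dots> < \<infinity>" by simp
  finally show ?thesis .
qed

text \<open>
  Off \<open>F\<close> the function \<open>f\<close> itself satisfies the inequality of \<open>suminf_avoid_finite\<close>. To obtain it on \<open>F\<close>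
  as well, add a multiple of \<open>w y = (\<Sum>n<M. avoid K x n y)\<close>. One step of the chain that is killed at \<open>x\<close>
  shifts the index of the summands, so by telescoping \<open>w\<close> decreases by \<open>1 - avoid K x M y\<close>: this is nonnegative
  everywhere, and positive on the finite set \<open>F\<close> once \<open>M\<close> is so large that \<open>x\<close> is accessible from every
  point of \<open>F\<close> within \<open>M\<close> steps.
\<close>

lemma foster_criterion:
  fixes f :: "'s \<Rightarrow> real"
  assumes fin: "\<And>y. finite (set_pmf (K y))"
    and closed: "\<And>y. y \<in> S \<Longrightarrow> set_pmf (K y) \<subseteq> S"
    and irred: "\<And>y x. y \<in> S \<Longrightarrow> x \<in> S \<Longrightarrow> (y, x) \<in> {(a, b). b \<in> set_pmf (K a)}\<^sup>+"
    and nonneg: "\<And>y. y \<in> S \<Longrightarrow> 0 \<le> f y"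
    and F: "finite F" "F \<subseteq> S"
    and drift: "\<And>y. y \<in> S - F \<Longrightarrow> measure_pmf.expectation (K y) f \<le> f y - 1"
  shows "positive_recurrent K S"
  unfolding positive_recurrent_def
proof
  fix x assume x: "x \<in> S"
  have "\<forall>y\<in>F. \<exists>n. avoid K x n y < 1"
    using avoid_less_1[of K, OF fin] irred x F(2) by blast
  then obtain n where n: "\<And>y. y \<in> F \<Longrightarrow> avoid K x (n y) y < 1" by metis
  define M where "M = Max (insert 0 (n ` F))"
  have M: "avoid K x M y < 1" if "y \<in> F" for y
  proof -
    have "n y \<le> M" unfolding M_def using that F(1) by (intro Max_ge) auto
    then have "avoid K x M y \<le> avoid K x (n y) y"
      using lift_Suc_antimono_le[of "\<lambda>n. avoid K x n y", OF avoid_Suc_le[OF fin]] by blast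
    then show ?thesis using n[OF that] by simp
  qed
  \<comment> \<open>\<open>b\<close> is the defect of \<open>f\<close> in the required inequality, and \<open>c\<close> is large enough to cover it on \<open>F\<close>.\<close>
  define b where "b y = measure_pmf.expectation (K y) f - f y + 1" for y
  define c where "c = Max (insert 0 ((\<lambda>y. b y / (1 - avoid K x M y)) ` F))"
  have c: "b y \<le> c * (1 - avoid K x M y)" if "y \<in> F" for y
  proof -
    have "b y / (1 - avoid K x M y) \<le> c" unfolding c_def using F(1) that by (intro Max_ge) auto
    then show "b y \<le> c * (1 - avoid K x M y)" using M[OF that] by (simp add: field_simps)
  qed
  have c0: "0 \<le> c" unfolding c_def using F(1) by (intro Max_ge) auto
  define w where "w y = (\<Sum>n<M. avoid K x n y)" for y
  define g where "g y = f y + c * w y" for y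
  have w_nonneg: "0 \<le> w y" for y
    unfolding w_def by (intro sum_nonneg avoid_bounds(1)[OF fin])
  have w_step: "measure_pmf.expectation (K y) (\<lambda>z. if z = x then 0 else w z) =
      w y - (1 - avoid K x M y)" for y
  proof -
    have "measure_pmf.expectation (K y) (\<lambda>z. if z = x then 0 else w z) =
        measure_pmf.expectation (K y) (\<lambda>z. \<Sum>n<M. if z = x then 0 else avoid K x n z)"
      by (intro Bochner_Integration.integral_cong) (auto simp: w_def)
    also have "\<dots> = (\<Sum>n<M. avoid K x (Suc n) y)"
      by (simp add: integrable_measure_pmf_finite[OF fin])
    also have "\<dots> = (\<Sum>n<Suc M. avoid K x n y) - 1"
      by (subst sum.lessThan_Suc_shift) simp
    also have "\<dots> = w y - (1 - avoid K x M y)" by (simp add: w_def)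
    finally show ?thesis .
  qed
  have "(\<Sum>n. ennreal (avoid K x n x)) < \<infinity>"
  proof (rule suminf_avoid_finite[OF fin closed _ _ x, where g=g])
    fix y assume y: "y \<in> S"
    show "0 \<le> g y" unfolding g_def using nonneg[OF y] c0 w_nonneg[of y] by simp
    have "measure_pmf.expectation (K y) (\<lambda>z. if z = x then 0 else g z)
        \<le> measure_pmf.expectation (K y) (\<lambda>z. f z + c * (if z = x then 0 else w z))"
      using closed[OF y] nonneg by (intro expectation_mono_finite fin) (auto simp: g_def)
    also have "\<dots> = measure_pmf.expectation (K y) f
        + c * measure_pmf.expectation (K y) (\<lambda>z. if z = x then 0 else w z)"
      by (simp add: integrable_measure_pmf_finite[OF fin])
    also have "\<dots> = g y - 1 + (b y - c * (1 - avoid K x M y))"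
      unfolding w_step by (simp add: g_def b_def algebra_simps)
    also have "\<dots> \<le> g y - 1"
    proof (cases "y \<in> F")
      case False
      have "b y \<le> 0" using drift[of y] y False by (simp add: b_def)
      moreover have "0 \<le> c * (1 - avoid K x M y)"
        using c0 avoid_bounds(2)[of K x M y, OF fin] by simp
      ultimately show ?thesis by simp
    qed (use c in simp)
    finally show "measure_pmf.expectation (K y) (\<lambda>z. if z = x then 0 else g z) \<le> g y - 1" .
  qed
  then show "(\<integral>\<^sup>+\<omega>. return_time x \<omega> \<partial>chain_law K x) < \<infinity>"
    using expected_return_time_le[of K, OF fin] by (rule le_less_trans[rotated])
qed


section \<open>Buffers after one arrival\<close>

lemma count_list_remove_oldest:
  "count_list (remove_oldest A w) c = count_list w c - of_bool (c \<in> A)"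
  by (induction A w rule: remove_oldest.induct) (auto simp: of_bool_def)

lemma set_remove_oldest_subset: "set (remove_oldest A w) \<subseteq> set w"
proof
  fix c
  assume "c \<in> set (remove_oldest A w)"
  then have "count_list w c \<noteq> 0"
    using count_list_remove_oldest[of A w c] count_list_0_iff[of "remove_oldest A w" c] by auto
  then show "c \<in> set w" by (simp add: count_list_0_iff)
qed

lemma length_remove_oldest:
  assumes "A \<subseteq> set w"
  shows "length (remove_oldest A w) = length w - card A"
proof -
  have "length (remove_oldest A w) = (\<Sum>c\<in>set w. count_list (remove_oldest A w) c)"
    by (rule sum_count_set[OF set_remove_oldest_subset, symmetric]) simp
  also have "\<dots> = (\<Sum>c\<in>set w. count_list w c) - (\<Sum>c\<in>set w. of_bool (c \<in> A))"
    unfolding count_list_remove_oldest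
    by (rule sum_subtractf_nat) (use count_list_0_iff in \<open>fastforce simp: Suc_le_eq\<close>)
  also have "(\<Sum>c\<in>set w. of_bool (c \<in> A)) = card A"
    using assms by (simp add: of_bool_def sum.If_cases Int_absorb1)
  finally show ?thesis by (simp add: sum_count_set)
qed

lemma set_pmf_match_the_longest:
  assumes "finite H" "matches H w v \<noteq> {}"
  shows "set_pmf (match_the_longest H w v) =
    {S \<in> matches H w v. \<forall>S'\<in>matches H w v. sum (count_list w) S' \<le> sum (count_list w) S}"
proof -
  let ?M = "matches H w v"
  let ?A = "{S. is_arg_max (\<lambda>S. \<Sum>i\<in>S. count_list w i) (\<lambda>S. S \<in> ?M) S}"
  have A: "?A = {S \<in> ?M. \<forall>S'\<in>?M. sum (count_list w) S' \<le> sum (count_list w) S}"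
    by (auto simp: is_arg_max_linorder)
  have fin: "finite ?M"
    using assms(1) by (simp add: matches_def)
  have "Max (sum (count_list w) ` ?M) \<in> sum (count_list w) ` ?M"
    using fin assms(2) by (intro Max_in) auto
  then obtain S where S: "S \<in> ?M" "sum (count_list w) S = Max (sum (count_list w) ` ?M)"
    by auto
  then have "S \<in> ?A"
    unfolding A using fin by simp
  moreover have "finite ?A"
    unfolding A using fin by simp
  ultimately have "set_pmf (match_the_longest H w v) = ?A"
    unfolding match_the_longest_def by (intro set_pmf_of_set) blast+
  then show ?thesis unfolding A .
qed

text \<open>
  The law of the next buffer given the class of the arriving item.
\<close>

definition arrival :: "'a set set \<Rightarrow> 'a list \<Rightarrow> 'a \<Rightarrow> 'a list pmf" where
  "arrival H w v = (if matches H w v = {} then return_pmf (w @ [v])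
     else map_pmf (\<lambda>S. remove_oldest (S - {v}) w) (match_the_longest H w v))"

lemma matching_step_arrival: "matching_step H match_the_longest \<mu> w = bind_pmf \<mu> (arrival H w)"
  by (simp add: matching_step_def arrival_def[abs_def])

lemma arrival_cases:
  assumes "finite H" "w' \<in> set_pmf (arrival H w v)"
  obtains (store) "matches H w v = {}" "w' = w @ [v]"
  | (match) S where "S \<in> matches H w v" "w' = remove_oldest (S - {v}) w"
      "\<And>S'. S' \<in> matches H w v \<Longrightarrow> sum (count_list w) S' \<le> sum (count_list w) S"
  using assms by (auto simp: arrival_def set_pmf_match_the_longest split: if_splits)

lemma finite_set_pmf_arrival: "finite H \<Longrightarrow> finite (set_pmf (arrival H w v))"
  by (auto simp: arrival_def set_pmf_match_the_longest matches_def)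

lemma expectation_bind_le:
  fixes f :: "'b \<Rightarrow> real"
  assumes "finite (set_pmf p)" "\<And>v. finite (set_pmf (q v))"
    and "\<And>v z. v \<in> set_pmf p \<Longrightarrow> z \<in> set_pmf (q v) \<Longrightarrow> f z \<le> g v"
  shows "measure_pmf.expectation (bind_pmf p q) f \<le> (\<Sum>v\<in>set_pmf p. pmf p v * g v)"
proof -
  have "measure_pmf.expectation (q v) f \<le> g v" if "v \<in> set_pmf p" for v
    using expectation_mono_finite[of "q v" f "\<lambda>_. g v"] assms that by simp
  then show ?thesis
    using assms by (subst pmf_expectation_bind[of "set_pmf p"]) (auto intro!: sum_mono mult_left_mono)
qed

section \<open>Complete 3-uniform hypergraphs with disjoint hyperedges removed\<close>

locale pruned_hypergraph =
  fixes V :: "'a set" and J :: "'a set set"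
  assumes finite_V: "finite V" and card_V: "card V \<ge> 5"
    and J_triples: "J \<subseteq> nsets V 3" and disjoint_J: "pairwise disjnt J"
begin

abbreviation E :: "'a set set" where "E \<equiv> nsets V 3 - J"

abbreviation S :: "'a list set" where "S \<equiv> buffer_words V E"

lemma finite_E: "finite E"
  using finite_V finite_imp_finite_nsets by blast

lemma J_unique: "A \<in> J \<Longrightarrow> B \<in> J \<Longrightarrow> a \<in> A \<Longrightarrow> a \<in> B \<Longrightarrow> A = B"
  using disjoint_J by (auto simp: pairwise_def disjnt_def)

text \<open>
  The new triple still shares two classes with \<open>T\<close>, so it is not one of the other removed triples.
\<close>

lemma triple_swap_in_E:
  assumes T: "T \<in> J" and a: "a \<in> T" and d: "d \<in> V - T"
  shows "insert d (T - {a}) \<in> E"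
proof -
  have T3: "T \<subseteq> V" "finite T" "card T = 3"
    using T J_triples by (auto simp: nsets_def)
  then have 3: "card (insert d (T - {a})) = 3"
    using a d by (simp add: card_insert_if)
  have "card (T - {a}) = 2" using T3 a by simp
  then obtain b where "b \<in> T - {a}" by (metis card.empty equals0I zero_neq_numeral)
  then have "insert d (T - {a}) \<notin> J"
    using J_unique[OF T, of "insert d (T - {a})" b] d by blast
  then show ?thesis
    using 3 T3 d by (auto simp: nsets_def)
qed

text \<open>
  If the buffer held a removed triple \<open>T\<close> and a further class, then exchanging that class for one of
  \<open>T\<close> would give a hyperedge inside the buffer.
\<close>

lemma buffer_classes:
  assumes w: "w \<in> S"
  shows "card (set w) \<le> 2 \<or> set w \<in> J"
proof (cases "card (set w) \<le> 2")
  case False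
  then have "3 \<le> card (set w)" by simp
  then obtain T where T: "T \<subseteq> set w" "card T = 3" "finite T"
    using obtain_subset_with_card_n by metis
  have wV: "set w \<subseteq> V" and noE: "\<And>A. A \<in> E \<Longrightarrow> \<not> A \<subseteq> set w"
    using w by (auto simp: buffer_words_def)
  have TJ: "T \<in> J"
    using T wV noE[of T] by (auto simp: nsets_def)
  have "set w \<subseteq> T"
  proof
    fix d assume d: "d \<in> set w"
    obtain a where a: "a \<in> T" using T by (metis card.empty equals0I zero_neq_numeral)
    show "d \<in> T"
    proof (rule ccontr)
      assume "d \<notin> T"
      then have "insert d (T - {a}) \<in> E"
        using triple_swap_in_E[OF TJ a] d wV by blast
      then show False using noE d T(1) by blast
    qed
  qed
  with T(1) TJ have "set w \<in> J" by (metis subset_antisym)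
  then show ?thesis ..
qed simp

lemma card_buffer_classes: "w \<in> S \<Longrightarrow> card (set w) \<le> 3"
  using buffer_classes[of w] J_triples by (auto simp: nsets_def)

lemma matchesD:
  assumes "A \<in> matches E w v"
  shows "A \<in> E" "v \<in> A" "A - {v} \<subseteq> set w" "A \<subseteq> V" "finite A" "card A = 3" "card (A - {v}) = 2"
  using assms by (auto simp: matches_def nsets_def)

text \<open>
  At most one of the at least three further vertices completes \<open>p, q\<close> to a removed triple.
\<close>

lemma pair_completes_in_E:
  assumes "p \<in> V" "q \<in> V" "p \<noteq> q"
  obtains l where "l \<in> V" "l \<noteq> p" "l \<noteq> q" "{p, q, l} \<in> E"
proof -
  have "card (V - {p, q}) \<ge> 2"
    using finite_V card_V assms by (simp add: card_Diff_subset)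
  then obtain B where "B \<subseteq> V - {p, q}" "card B = 2"
    using obtain_subset_with_card_n by metis
  then obtain k l where kl: "k \<in> V - {p, q}" "l \<in> V - {p, q}" "k \<noteq> l"
    by (auto simp: card_2_iff)
  have trip: "{p, q, x} \<in> nsets V 3" if "x \<in> V - {p, q}" for x
    using that assms by (auto simp: nsets_def)
  have "\<not> ({p, q, k} \<in> J \<and> {p, q, l} \<in> J)"
    using J_unique[of "{p, q, k}" "{p, q, l}" p] kl by auto
  then show ?thesis using that kl trip by blast
qed

section \<open>Irreducibility\<close>

lemma arrival_closed:
  assumes w: "w \<in> S" and v: "v \<in> V" and w': "w' \<in> set_pmf (arrival E w v)"
  shows "w' \<in> S"
  using finite_E w'
proof (cases rule: arrival_cases)
  case store
  have "\<not> A \<subseteq> set (w @ [v])" if "A \<in> E" for A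
    using that store(1) w unfolding matches_def buffer_words_def by auto
  then show ?thesis using store w v by (auto simp: buffer_words_def)
next
  case (match A)
  then have "set w' \<subseteq> set w"
    using set_remove_oldest_subset[of "A - {v}" w] by simp
  then show ?thesis
    using w unfolding buffer_words_def in_lists_conv_set mem_Collect_eq by blast
qed

definition transitions :: "'a pmf \<Rightarrow> ('a list \<times> 'a list) set" where
  "transitions \<mu> = {(w, w'). w' \<in> set_pmf (matching_step E match_the_longest \<mu> w)}"

lemma transition_arrival: "v \<in> set_pmf \<mu> \<Longrightarrow> w' \<in> set_pmf (arrival E w v) \<Longrightarrow> (w, w') \<in> transitions \<mu>"
  by (auto simp: transitions_def matching_step_arrival)

lemma transition_closed:
  assumes "set_pmf \<mu> = V" "w \<in> S" "(w, w') \<in> transitions \<mu>"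
  shows "w' \<in> S"
proof -
  obtain v where "v \<in> set_pmf \<mu>" "w' \<in> set_pmf (arrival E w v)"
    using assms(3) by (auto simp: transitions_def matching_step_arrival)
  then show ?thesis using arrival_closed[of w v w'] assms by simp
qed

lemma transition_store:
  assumes "w @ [v] \<in> S" "set_pmf \<mu> = V"
  shows "w \<in> S" "(w, w @ [v]) \<in> transitions \<mu>"
proof -
  show "w \<in> S" using assms by (auto simp: buffer_words_def)
  have "matches E w v = {}"
    using assms(1) by (auto simp: matches_def buffer_words_def)
  then show "(w, w @ [v]) \<in> transitions \<mu>"
    using assms by (intro transition_arrival) (auto simp: arrival_def buffer_words_def)
qed

text \<open>
  Every prefix of a buffer word is a buffer word, so the word builds up letter by letter without
  any match.
\<close>

lemma reach_from_Nil:
  assumes "set_pmf \<mu> = V" "w \<in> S"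
  shows "([], w) \<in> (transitions \<mu>)\<^sup>*"
  using assms(2)
proof (induction w rule: rev_induct)
  case (snoc v w)
  then show ?case
    using transition_store[OF snoc.prems assms(1)] by (meson rtrancl.rtrancl_into_rtrancl)
qed simp

lemma transition_shorter_if_two_classes:
  assumes \<mu>: "set_pmf \<mu> = V" and w: "w \<in> S" and pq: "p \<in> set w" "q \<in> set w" "p \<noteq> q"
  obtains w' where "(w, w') \<in> transitions \<mu>" "w' \<in> S" "length w' + 2 = length w"
proof -
  have "set w \<subseteq> V" using w by (auto simp: buffer_words_def)
  then obtain l where l: "l \<in> V" "l \<noteq> p" "l \<noteq> q" "{p, q, l} \<in> E"
    using pair_completes_in_E[of p q] pq by blast
  then have m: "{p, q, l} \<in> matches E w l"
    using pq by (auto simp: matches_def)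
  obtain w' where w': "w' \<in> set_pmf (arrival E w l)"
    using set_pmf_not_empty[of "arrival E w l"] by blast
  have "length w' + 2 = length w"
    using finite_E w'
  proof (cases rule: arrival_cases)
    case store
    then show ?thesis using m by blast
  next
    case (match A)
    have "card (A - {l}) \<le> card (set w)"
      using matchesD(3)[OF match(1)] by (simp add: card_mono)
    also have "\<dots> \<le> length w" by (rule card_length)
    finally show ?thesis
      using match length_remove_oldest[OF matchesD(3)[OF match(1)]] matchesD(7)[OF match(1)] by simp
  qed
  moreover have "(w, w') \<in> transitions \<mu>"
    using w' l \<mu> by (intro transition_arrival) auto
  ultimately show ?thesis
    using that transition_closed[OF \<mu> w] by blast
qed

text \<open>
  Two stored classes lose an item each when a vertex completing them arrives. If only one class is
  stored, an item of another class is stored before, and the two arrivals together still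
  shorten the buffer by one.
\<close>

lemma reach_Nil:
  assumes \<mu>: "set_pmf \<mu> = V" and "w \<in> S"
  shows "(w, []) \<in> (transitions \<mu>)\<^sup>*"
  using assms(2)
proof (induction "length w" arbitrary: w rule: less_induct)
  case less
  consider "w = []" | p q where "p \<in> set w" "q \<in> set w" "p \<noteq> q" | p where "set w = {p}"
    by (cases w) auto
  then show ?case
  proof cases
    case 2
    then obtain w' where "(w, w') \<in> transitions \<mu>" "w' \<in> S" "length w' + 2 = length w"
      using transition_shorter_if_two_classes[OF \<mu> less.prems] by blast
    then show ?thesis
      using less.hyps[of w'] by (simp add: converse_rtrancl_into_rtrancl)
  next
    case 3
    have pV: "p \<in> V" using 3 less.prems by (auto simp: buffer_words_def)
    have "V \<noteq> {p}" using card_V by auto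
    then obtain q where q: "q \<in> V" "q \<noteq> p" using pV by blast
    have wq: "w @ [q] \<in> S"
    proof -
      have "\<not> A \<subseteq> {p, q}" if "A \<in> E" for A
      proof
        assume "A \<subseteq> {p, q}"
        then have "card A \<le> card {p, q}" by (intro card_mono) auto
        then show False using that q by (simp add: nsets_def)
      qed
      then show ?thesis using 3 pV q by (auto simp: buffer_words_def insert_commute)
    qed
    obtain w' where "(w @ [q], w') \<in> transitions \<mu>" "w' \<in> S" "length w' + 2 = length (w @ [q])"
      using transition_shorter_if_two_classes[OF \<mu> wq, of p q] 3 q by auto
    moreover have "(w, w @ [q]) \<in> transitions \<mu>" by (rule transition_store(2)[OF wq \<mu>])
    ultimately show ?thesis
      using less.hyps[of w'] by (simp add: converse_rtrancl_into_rtrancl)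
  qed simp
qed

lemma transitions_irreducible:
  assumes \<mu>: "set_pmf \<mu> = V" and "w \<in> S" "w' \<in> S"
  shows "(w, w') \<in> (transitions \<mu>)\<^sup>+"
proof -
  obtain v where v: "v \<in> V" using card_V by fastforce
  have vS: "[v] \<in> S"
  proof -
    have "\<not> A \<subseteq> {v}" if "A \<in> E" for A
      using that card_mono[of "{v}" A] by (auto simp: nsets_def)
    then show ?thesis using v by (auto simp: buffer_words_def)
  qed
  have "([], [v]) \<in> transitions \<mu>"
    using transition_store(2)[of "[]" v] vS \<mu> by simp
  then have "([], []) \<in> (transitions \<mu>)\<^sup>+"
    using reach_Nil[OF \<mu> vS] by (rule rtrancl_into_trancl2)
  then show ?thesis
    using reach_Nil[OF \<mu> assms(2)] reach_from_Nil[OF \<mu> assms(3)]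
    by (meson rtrancl_trancl_trancl trancl_rtrancl_trancl)
qed

section \<open>The drift of the energy\<close>

text \<open>
  This is \<open>Q + e * n\<^sup>2\<close>, where \<open>Q = (3 * (\<Sum>c. x(c)\<^sup>2) - n\<^sup>2) / 2\<close> has half-gradient
  \<open>x(c) - (\<Sum>c' \<noteq> c. x(c')) / 2\<close> in direction \<open>c\<close>.
\<close>

definition energy :: "real \<Rightarrow> 'a list \<Rightarrow> real" where
  "energy e w = 3 / 2 * (\<Sum>c\<in>V. (real (count_list w c))\<^sup>2) - (1 / 2 - e) * (real (length w))\<^sup>2"

lemma length_eq_sum_count: "set w \<subseteq> V \<Longrightarrow> real (length w) = (\<Sum>c\<in>V. real (count_list w c))"
  using finite_V by (simp flip: of_nat_sum add: sum_count_set)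

text \<open>
  At most three classes are present, so \<open>n\<^sup>2 \<le> 3 * (\<Sum>c. x(c)\<^sup>2)\<close> by the Cauchy-Schwarz inequality.
\<close>

lemma energy_nonneg:
  assumes w: "w \<in> S" and e: "0 \<le> e" "e \<le> 1 / 2"
  shows "0 \<le> energy e w"
proof -
  have wV: "set w \<subseteq> V" using w by (auto simp: buffer_words_def)
  have "real (length w) = (\<Sum>c\<in>set w. real (count_list w c))"
    by (simp flip: of_nat_sum add: sum_count_set)
  then have "(real (length w))\<^sup>2 \<le> (\<Sum>c\<in>set w. (real (count_list w c))\<^sup>2) * card (set w)"
    using sum_squared_le_sum_of_squares[of "\<lambda>c. real (count_list w c)" "set w"] by simp
  also have "\<dots> \<le> (\<Sum>c\<in>set w. (real (count_list w c))\<^sup>2) * 3"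
    using card_buffer_classes[OF w] by (intro mult_left_mono sum_nonneg) auto
  also have "(\<Sum>c\<in>set w. (real (count_list w c))\<^sup>2) = (\<Sum>c\<in>V. (real (count_list w c))\<^sup>2)"
    using wV finite_V by (intro sum.mono_neutral_left) auto
  finally have *: "(real (length w))\<^sup>2 \<le> 3 * (\<Sum>c\<in>V. (real (count_list w c))\<^sup>2)" by simp
  have "(1 / 2 - e) * (real (length w))\<^sup>2 \<le> 1 / 2 * (real (length w))\<^sup>2"
    using e by (intro mult_right_mono) auto
  then show ?thesis unfolding energy_def using * by simp
qed

lemma energy_after_store:
  assumes v: "v \<in> V" and e: "e \<le> 1 / 2"
  shows "energy e (w @ [v]) \<le> energy e w + 3 + 3 * real (count_list w v) - (1 - 2 * e) * real (length w)"
proof -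
  let ?x = "\<lambda>c. real (count_list w c)"
  have "(\<Sum>c\<in>V. (real (count_list (w @ [v]) c))\<^sup>2) = (\<Sum>c\<in>V. (?x c)\<^sup>2 + (if c = v then 2 * ?x c + 1 else 0))"
    by (intro sum.cong) (auto simp: power2_eq_square algebra_simps)
  also have "\<dots> = (\<Sum>c\<in>V. (?x c)\<^sup>2) + 2 * ?x v + 1"
    using v finite_V by (simp add: sum.distrib)
  finally have "energy e (w @ [v]) = energy e w + 3 * ?x v + 3 / 2 - (1 / 2 - e) * (2 * length w + 1)"
    unfolding energy_def by (simp add: power2_eq_square algebra_simps)
  then show ?thesis using e by (simp add: algebra_simps)
qed

lemma energy_after_match:
  assumes w: "set w \<subseteq> V" and A: "A \<subseteq> set w" "card A = 2" and e: "e \<le> 1 / 2"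
  shows "energy e (remove_oldest A w) \<le>
    energy e w + 3 - 3 * (\<Sum>c\<in>A. real (count_list w c)) + 2 * (1 - 2 * e) * real (length w)"
proof -
  let ?x = "\<lambda>c. real (count_list w c)"
  have AV: "A \<subseteq> V" using w A by blast
  have pos: "1 \<le> count_list w c" if "c \<in> A" for c
    using that A count_list_0_iff[of w c] by (simp add: Suc_le_eq subset_iff)
  have dec: "real (count_list w c - Suc 0) = ?x c - 1" if "c \<in> A" for c
    using pos[OF that] by simp
  have len: "real (length (remove_oldest A w)) = real (length w) - 2"
  proof -
    have "2 \<le> length w"
      using A card_mono[of "set w" A] card_length[of w] by simp
    then show ?thesis using length_remove_oldest[OF A(1)] A(2) by simp
  qed
  have "(\<Sum>c\<in>V. (real (count_list (remove_oldest A w) c))\<^sup>2) =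
      (\<Sum>c\<in>V. (?x c)\<^sup>2 + (if c \<in> A then 1 - 2 * ?x c else 0))"
    by (intro sum.cong) (auto simp: count_list_remove_oldest dec power2_eq_square algebra_simps)
  also have "\<dots> = (\<Sum>c\<in>V. (?x c)\<^sup>2) + (\<Sum>c\<in>A. 1 - 2 * ?x c)"
    using finite_V AV by (simp add: sum.distrib sum.If_cases Int_absorb1)
  also have "(\<Sum>c\<in>A. 1 - 2 * ?x c) = 2 - 2 * (\<Sum>c\<in>A. ?x c)"
    using A by (simp add: sum_subtractf sum_distrib_left)
  finally have "energy e (remove_oldest A w) =
      energy e w + 3 - 3 * (\<Sum>c\<in>A. ?x c) - (1 / 2 - e) * (4 - 4 * real (length w))"
    unfolding energy_def len by (simp add: power2_eq_square algebra_simps)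
  then show ?thesis using e by (simp add: algebra_simps)
qed

text \<open>
  The bound for storing the item also covers a match: the two matched classes are then the
  only ones in the buffer, so the first-order change is \<open>- 3 * n + 2 * (1 - 2 * e) * n\<close>, and this is at
  most \<open>- (1 - 2 * e) * n\<close>. One formula for all \<open>v\<close> makes averaging over \<open>v\<close> immediate.
\<close>

lemma energy_after_arrival_two_classes:
  assumes w: "w \<in> S" and two: "card (set w) \<le> 2" and v: "v \<in> V"
    and e: "0 \<le> e" "e \<le> 1 / 2" and w': "w' \<in> set_pmf (arrival E w v)"
  shows "energy e w' \<le> energy e w + 3 + 3 * real (count_list w v) - (1 - 2 * e) * real (length w)"
  using finite_E w'
proof (cases rule: arrival_cases)
  case store
  then show ?thesis using energy_after_store[OF v e(2)] by simp
next
  case (match A)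
  note A = matchesD[OF match(1)]
  have wV: "set w \<subseteq> V" using w by (auto simp: buffer_words_def)
  have eq: "A - {v} = set w"
    using A(3,7) two by (intro card_seteq) auto
  then have v0: "count_list w v = 0" by (auto simp: count_list_0_iff)
  have sum: "(\<Sum>c\<in>set w. real (count_list w c)) = real (length w)"
    by (simp flip: of_nat_sum add: sum_count_set)
  have "energy e w' \<le> energy e w + 3 - 3 * real (length w) + 2 * (1 - 2 * e) * real (length w)"
    using energy_after_match[OF wV A(3,7) e(2)] unfolding match(2) eq sum .
  also have "\<dots> \<le> energy e w + 3 - (1 - 2 * e) * real (length w)"
    using e by (simp add: algebra_simps)
  finally show ?thesis using v0 by simp
qed

text \<open>
  This is where the policy enters: an arrival from outside the triple may be matched with any two of
  the three classes, so the longest match removes items of two classes with total count at least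
  \<open>n - x(a)\<close>, whichever \<open>a\<close> is left out.
\<close>

lemma energy_after_arrival_triple:
  assumes w: "w \<in> S" and T: "set w \<in> J" and v: "v \<in> V" and a: "a \<in> set w"
    and e: "0 \<le> e" "e \<le> 1 / 2" and w': "w' \<in> set_pmf (arrival E w v)"
  shows "energy e w' \<le> energy e w + 3 +
    (if v \<in> set w then 3 * real (count_list w v) - (1 - 2 * e) * real (length w)
     else 3 * real (count_list w a) - (1 + 4 * e) * real (length w))"
  using finite_E w'
proof (cases rule: arrival_cases)
  case store
  have "v \<in> set w"
  proof (rule ccontr)
    assume "v \<notin> set w"
    then have "insert v (set w - {a}) \<in> matches E w v"
      using triple_swap_in_E[OF T a, of v] v by (auto simp: matches_def)
    then show False using store by blast
  qed
  then show ?thesis using store energy_after_store[OF v e(2), of w] by simp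
next
  case (match A)
  note A = matchesD[OF match(1)]
  have wV: "set w \<subseteq> V" using w by (auto simp: buffer_words_def)
  have vw: "v \<notin> set w"
  proof
    assume "v \<in> set w"
    then have "A \<subseteq> set w" using A by blast
    then show False using A(1) w by (auto simp: buffer_words_def)
  qed
  then have v0: "count_list w v = 0" by simp
  have "insert v (set w - {a}) \<in> matches E w v"
    using triple_swap_in_E[OF T a, of v] v vw by (auto simp: matches_def)
  from match(3)[OF this] have "sum (count_list w) (set w - {a}) \<le> sum (count_list w) A"
    using vw v0 by simp
  also have "sum (count_list w) A = sum (count_list w) (A - {v})"
    using A(2,5) v0 by (simp add: sum.remove)
  finally have "real (sum (count_list w) (set w - {a})) \<le> (\<Sum>c\<in>A - {v}. real (count_list w c))"
    unfolding of_nat_sum[symmetric] of_nat_le_iff .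
  moreover have "length w = count_list w a + sum (count_list w) (set w - {a})"
    using a sum_count_set[of w "set w"] by (simp add: sum.remove[of "set w" a])
  ultimately have "real (length w) - count_list w a \<le> (\<Sum>c\<in>A - {v}. real (count_list w c))"
    by simp
  then show ?thesis
    using energy_after_match[OF wV A(3,7) e(2)] vw unfolding match(2) by (simp add: algebra_simps)
qed

text \<open>
  With at most two classes, averaging the gain \<open>3 * x(v) - (1 - 2 * e) * n\<close> gives at most
  \<open>(3 * M - 1 + 2 * e) * n\<close>. On a triple \<open>T\<close> with smallest count \<open>x(a)\<close>, write
  \<open>x(v) = x(a) + (x(v) - x(a))\<close>. The excesses \<open>x(v) - x(a)\<close> contribute at most their sum
  \<open>n - 3 * x(a)\<close>, because \<open>3 * \<mu>(v) \<le> 1\<close>; then all terms free of \<open>e\<close> cancel and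
  \<open>- 2 * e * (2 - 3 * \<mu>(T)) * n\<close> remains.
\<close>

lemma energy_drift:
  assumes \<mu>: "set_pmf \<mu> = V" and w: "w \<in> S" and e: "0 \<le> e" "e \<le> 1 / 2"
    and M: "\<And>v. v \<in> V \<Longrightarrow> pmf \<mu> v \<le> M" "M \<le> 1 / 3"
    and k: "\<And>T. T \<in> J \<Longrightarrow> measure_pmf.prob \<mu> T \<le> k"
    and d: "d \<le> 1 - 3 * M - 2 * e" "d \<le> 2 * e * (2 - 3 * k)"
  shows "measure_pmf.expectation (matching_step E match_the_longest \<mu> w) (energy e)
    \<le> energy e w + 3 - d * real (length w)"
proof -
  let ?n = "real (length w)" and ?x = "\<lambda>c. real (count_list w c)" and ?m = "pmf \<mu>"
  have wV: "set w \<subseteq> V" using w by (auto simp: buffer_words_def)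
  have total: "(\<Sum>v\<in>V. ?m v) = 1"
    using \<mu> finite_V by (intro sum_pmf_eq_1) auto
  have len_set: "(\<Sum>c\<in>set w. ?x c) = ?n"
    by (simp flip: of_nat_sum add: sum_count_set)
  have conclude: ?thesis
    if gain: "\<And>v w'. v \<in> V \<Longrightarrow> w' \<in> set_pmf (arrival E w v) \<Longrightarrow> energy e w' \<le> energy e w + 3 + g v"
      and avg: "(\<Sum>v\<in>V. ?m v * g v) \<le> - d * ?n" for g
  proof -
    have "measure_pmf.expectation (matching_step E match_the_longest \<mu> w) (energy e)
        \<le> (\<Sum>v\<in>V. ?m v * (energy e w + 3 + g v))"
      unfolding matching_step_arrival \<mu>[symmetric]
      using gain finite_V \<mu> finite_set_pmf_arrival[OF finite_E] by (intro expectation_bind_le) auto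
    also have "\<dots> = (\<Sum>v\<in>V. (energy e w + 3) * ?m v + ?m v * g v)"
      by (intro sum.cong) (simp_all add: algebra_simps)
    also have "\<dots> = (energy e w + 3) * (\<Sum>v\<in>V. ?m v) + (\<Sum>v\<in>V. ?m v * g v)"
      by (simp only: sum.distrib sum_distrib_left)
    finally show ?thesis using total avg by simp
  qed
  show ?thesis
  proof (cases "card (set w) \<le> 2")
    case True
    let ?g = "\<lambda>v. 3 * ?x v - (1 - 2 * e) * ?n"
    have "(\<Sum>v\<in>V. ?m v * ?g v) = 3 * (\<Sum>v\<in>V. ?m v * ?x v) - (1 - 2 * e) * ?n * (\<Sum>v\<in>V. ?m v)"
      by (simp add: sum_subtractf sum.distrib sum_distrib_left algebra_simps)
    also have "(\<Sum>v\<in>V. ?m v * ?x v) \<le> M * ?n"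
      unfolding length_eq_sum_count[OF wV] sum_distrib_left using M by (intro sum_mono mult_right_mono) auto
    finally have "(\<Sum>v\<in>V. ?m v * ?g v) \<le> - (1 - 3 * M - 2 * e) * ?n"
      using total by (simp add: algebra_simps)
    also have "\<dots> \<le> - d * ?n"
      using d by (intro mult_right_mono) auto
    finally have "(\<Sum>v\<in>V. ?m v * ?g v) \<le> - d * ?n" .
    moreover have "energy e w' \<le> energy e w + 3 + ?g v"
      if "v \<in> V" "w' \<in> set_pmf (arrival E w v)" for v w'
      using energy_after_arrival_two_classes[OF w True that(1) e that(2)] by simp
    ultimately show ?thesis by (intro conclude[of ?g])
  next
    case False
    then have T: "set w \<in> J" using buffer_classes[OF w] by blast
    then have T3: "card (set w) = 3" using J_triples by (auto simp: nsets_def)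
    then have "set w \<noteq> {}" by auto
    then have "Min (count_list w ` set w) \<in> count_list w ` set w" by (intro Min_in) auto
    then obtain a where a: "a \<in> set w" "count_list w a = Min (count_list w ` set w)" by auto
    have min: "?x a \<le> ?x c" if "c \<in> set w" for c
      using that unfolding of_nat_le_iff a(2) by (intro Min_le) auto
    let ?p = "\<Sum>v\<in>set w. ?m v"
    have p: "?p \<le> k"
      using k[OF T] by (simp add: measure_measure_pmf_finite)
    let ?g = "\<lambda>v. if v \<in> set w then 3 * ?x v - (1 - 2 * e) * ?n else 3 * ?x a - (1 + 4 * e) * ?n"
    have rest: "(\<Sum>v\<in>V - set w. ?m v) = 1 - ?p"
      using total sum_diff[OF finite_V wV, of ?m] by simp
    have excess: "(\<Sum>v\<in>set w. ?m v * (3 * (?x v - ?x a))) \<le> ?n - 3 * ?x a"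
    proof -
      have "(\<Sum>v\<in>set w. ?m v * (3 * (?x v - ?x a))) \<le> (\<Sum>v\<in>set w. ?x v - ?x a)"
      proof (rule sum_mono)
        fix v assume v: "v \<in> set w"
        then have "3 * ?m v \<le> 1" using M wV by fastforce
        then have "(3 * ?m v) * (?x v - ?x a) \<le> 1 * (?x v - ?x a)"
          using min[OF v] by (intro mult_right_mono) auto
        then show "?m v * (3 * (?x v - ?x a)) \<le> ?x v - ?x a" by (simp add: algebra_simps)
      qed
      also have "\<dots> = ?n - 3 * ?x a"
        using T3 len_set by (simp add: sum_subtractf)
      finally show ?thesis .
    qed
    have "(\<Sum>v\<in>V. ?m v * ?g v) =
        (\<Sum>v\<in>set w. ?m v * ?g v) + (\<Sum>v\<in>V - set w. ?m v * ?g v)"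
      using sum.subset_diff[OF wV finite_V, of "\<lambda>v. ?m v * ?g v"] by simp
    also have "(\<Sum>v\<in>V - set w. ?m v * ?g v) = (1 - ?p) * (3 * ?x a - (1 + 4 * e) * ?n)"
      unfolding rest[symmetric] sum_distrib_right by (intro sum.cong) auto
    also have "(\<Sum>v\<in>set w. ?m v * ?g v) =
        (\<Sum>v\<in>set w. ?m v * (3 * (?x v - ?x a))) + ?p * (3 * ?x a - (1 - 2 * e) * ?n)"
      unfolding sum_distrib_right sum.distrib[symmetric]
      by (intro sum.cong) (auto simp: algebra_simps)
    also note excess
    finally have "(\<Sum>v\<in>V. ?m v * ?g v) \<le> - (2 * e * (2 - 3 * ?p)) * ?n"
      by (simp add: algebra_simps)
    also have "\<dots> \<le> - d * ?n"
    proof (rule mult_right_mono)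
      have "2 * e * (2 - 3 * k) \<le> 2 * e * (2 - 3 * ?p)"
        using e p by (intro mult_left_mono) auto
      then show "- (2 * e * (2 - 3 * ?p)) \<le> - d" using d by simp
    qed simp
    finally have "(\<Sum>v\<in>V. ?m v * ?g v) \<le> - d * ?n" .
    moreover have "energy e w' \<le> energy e w + 3 + ?g v"
      if "v \<in> V" "w' \<in> set_pmf (arrival E w v)" for v w'
      using energy_after_arrival_triple[OF w T that(1) a(1) e that(2)] by simp
    ultimately show ?thesis by (intro conclude[of ?g])
  qed
qed

end


theorem theorem4p2:
  fixes V :: "'a set" and H J :: "'a set set" and \<mu> :: "'a pmf"
  assumes "complete_3_uniform V H"
    and "card V \<ge> 5"
    and "J \<subseteq> H"
    and "pairwise disjnt J"
    and "set_pmf \<mu> = V"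
    and "\<forall>i\<in>V - \<Union>J. lambda_poly V (pmf \<mu>) i < 0"
    and "\<forall>S\<in>J. \<forall>i\<in>S. nu_poly V S (pmf \<mu>) i < 0"
    and "\<forall>T. transversal V (H - J) T \<longrightarrow> measure_pmf.prob \<mu> T > 1 / 3"
    and "\<forall>i\<in>V. pmf \<mu> i < 1 / 3"
  shows "model_stable V (H - J) match_the_longest \<mu>"
proof -
  have finV: "finite V" and H: "H = nsets V 3"
    using assms(1) by (auto simp: complete_3_uniform_def hypergraph_def)
  interpret pruned_hypergraph V J
    using finV H assms by unfold_locales auto
  have V_ne: "V \<noteq> {}" using card_V by auto
  have fin_J: "finite J"
    using J_triples finV finite_imp_finite_nsets finite_subset by blast
  define M where "M = Max (pmf \<mu> ` V)"
  have M: "pmf \<mu> v \<le> M" if "v \<in> V" for v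
    unfolding M_def using that finV by (intro Max_ge) auto
  have M3: "M < 1 / 3"
    unfolding M_def using assms(9) finV V_ne by (subst Max_less_iff) auto
  have M0: "0 \<le> M" using V_ne M pmf_nonneg[of \<mu>] order_trans by blast
  \<comment> \<open>A hyperedge that misses \<open>V - T\<close> would be \<open>T\<close> itself, so \<open>V - T\<close> is a transversal.\<close>
  have prob_J: "measure_pmf.prob \<mu> T < 2 / 3" if "T \<in> J" for T
  proof -
    have T: "T \<subseteq> V" "finite T" "card T = 3"
      using J_triples that by (auto simp: nsets_def)
    have "(V - T) \<inter> A \<noteq> {}" if "A \<in> E" for A
    proof
      assume "(V - T) \<inter> A = {}"
      then have "A \<subseteq> T" using \<open>A \<in> E\<close> by (auto simp: nsets_def)
      then have "A = T" using T \<open>A \<in> E\<close> by (intro card_subset_eq) (auto simp: nsets_def)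
      then show False using \<open>A \<in> E\<close> \<open>T \<in> J\<close> by blast
    qed
    then have "transversal V (H - J) (V - T)"
      unfolding H transversal_def by blast
    then have "1 / 3 < measure_pmf.prob \<mu> (V - T)" using assms(8) by blast
    moreover have "measure_pmf.prob \<mu> V = 1"
      using assms(5) by (simp add: measure_pmf.prob_eq_1 AE_measure_pmf_iff)
    ultimately show ?thesis
      using measure_pmf.finite_measure_Diff[of V \<mu> T] T by simp
  qed
  \<comment> \<open>Inserting \<open>0\<close> covers the case of an empty \<open>J\<close>.\<close>
  define k where "k = Max (insert 0 (measure_pmf.prob \<mu> ` J))"
  have k: "measure_pmf.prob \<mu> T \<le> k" if "T \<in> J" for T
    unfolding k_def using that fin_J by (intro Max_ge) auto
  have k3: "k < 2 / 3"
    unfolding k_def using prob_J fin_J by (subst Max_less_iff) auto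
  \<comment> \<open>Half of the room \<open>1 - 3 * M\<close> is spent on the term \<open>e * n\<^sup>2\<close>.\<close>
  define e where "e = (1 - 3 * M) / 4"
  have e: "0 < e" "e \<le> 1 / 2" using M3 M0 by (auto simp: e_def)
  define d where "d = min (1 - 3 * M - 2 * e) (2 * e * (2 - 3 * k))"
  have d: "0 < d" using M3 k3 e by (simp add: d_def) (simp add: e_def)
  \<comment> \<open>Outside \<open>F\<close> the drift bound \<open>3 - d * n\<close> is below \<open>- 1\<close>.\<close>
  define F where "F = {w \<in> S. real (length w) \<le> 4 / d}"
  have "F \<subseteq> {w. set w \<subseteq> V \<and> length w \<le> nat \<lceil>4 / d\<rceil>}"
    by (auto simp: F_def buffer_words_def le_nat_iff) linarith
  then have "finite F"
    using finite_lists_length_le[OF finV] finite_subset by blast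
  show ?thesis
    unfolding model_stable_def H
  proof (rule foster_criterion[where f="energy e" and F=F])
    show "finite (set_pmf (matching_step E match_the_longest \<mu> w))" for w
      using finV assms(5) finite_set_pmf_arrival[OF finite_E] by (simp add: matching_step_arrival)
    show "set_pmf (matching_step E match_the_longest \<mu> w) \<subseteq> S" if "w \<in> S" for w
      using transition_closed[OF assms(5) that] by (auto simp: transitions_def)
    show "(w, w') \<in> {(a, b). b \<in> set_pmf (matching_step E match_the_longest \<mu> a)}\<^sup>+"
      if "w \<in> S" "w' \<in> S" for w w'
      using transitions_irreducible[OF assms(5) that] by (simp add: transitions_def)
    show "0 \<le> energy e w" if "w \<in> S" for w
      using energy_nonneg[OF that] e by simp
    show "measure_pmf.expectation (matching_step E match_the_longest \<mu> w) (energy e) \<le> energy e w - 1"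
      if "w \<in> S - F" for w
    proof -
      have "measure_pmf.expectation (matching_step E match_the_longest \<mu> w) (energy e)
          \<le> energy e w + 3 - d * real (length w)"
        using that e M M3 k by (intro energy_drift[where M=M and k=k, OF assms(5)]) (auto simp: d_def)
      moreover have "4 \<le> d * real (length w)"
        using that d by (auto simp: F_def field_simps)
      ultimately show ?thesis by linarith
    qed
  qed (use \<open>finite F\<close> in \<open>auto simp: F_def\<close>)
qed

end
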